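(* Let $0\le\delta\le1/2$. If $(2\delta)^3+(2\delta)^2+2\delta>1$, then there is a counterexample to $\mathcal{K}(\delta)$; that is, there exists a configuration $C$ such that for every endpoint $c$ of $C$ there is a radius $\omega(c)>0$ with $\lambda(C|I_{\omega(c)}(c))\notin[\delta,1-\delta]$.
   Context: $\lambda$ is Lebesgue measure on $\mathbb{R}$. For $p\in\mathbb{R}$ and $\epsilon>0$, $I_\epsilon(p)=(p-\epsilon,p+\epsilon)$. For an interval $I$ of finite positive length $|I|$ and a measurable set $H\subset\mathbb{R}$, $\lambda(H|I)=\lambda(H\cap I)/|I|$. A configuration is a set $C=(-\infty,0)\cup\bigcup_{i=1}^r(a_i,b_i)$, where $0<a_1<b_1<a_2<b_2<\dots<a_r<b_r$ is a finite increasing sequence of positive reals; the endpoints of $C$ are $0,a_1,b_1,\dots,a_r,b_r$. For $0\le\delta\le1/2$, $\mathcal{K}(\delta)$ is the statement: for every configuration $C$ there is an endpoint $c$ of $C$ such that $\delta\le\lambda(C|I_\omega(c))\le1-\delta$ for all $\omega>0$. *)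

theory Defs
  imports "HOL-Analysis.Analysis"
begin

definition centered_interval :: "real \<Rightarrow> real \<Rightarrow> real set" where
  "centered_interval \<epsilon> p = {p - \<epsilon><..<p + \<epsilon>}"

definition cond_density :: "real set \<Rightarrow> real set \<Rightarrow> real" where
  "cond_density H I = measure lebesgue (H \<inter> I) / measure lebesgue I"

(* A configuration is given by the number r of its bounded intervals together with their
   endpoints; only the values of a and b at the indices 1, ..., r matter. *)

definition is_configuration :: "nat \<Rightarrow> (nat \<Rightarrow> real) \<Rightarrow> (nat \<Rightarrow> real) \<Rightarrow> bool" where
  "is_configuration r a b \<longleftrightarrow>
     1 \<le> r \<and> 0 < a 1 \<and> (\<forall>i\<in>{1..r}. a i < b i) \<and> (\<forall>i\<in>{1..<r}. b i < a (i + 1))"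

definition conf_set :: "nat \<Rightarrow> (nat \<Rightarrow> real) \<Rightarrow> (nat \<Rightarrow> real) \<Rightarrow> real set" where
  "conf_set r a b = {..<0} \<union> (\<Union>i\<in>{1..r}. {a i<..<b i})"

definition conf_endpoints :: "nat \<Rightarrow> (nat \<Rightarrow> real) \<Rightarrow> (nat \<Rightarrow> real) \<Rightarrow> real set" where
  "conf_endpoints r a b = {0} \<union> a ` {1..r} \<union> b ` {1..r}"

definition K_property :: "real \<Rightarrow> bool" where
  "K_property \<delta> \<longleftrightarrow>
     (\<forall>r a b. is_configuration r a b \<longrightarrow>
        (\<exists>c\<in>conf_endpoints r a b. \<forall>\<omega>>0.
           \<delta> \<le> cond_density (conf_set r a b) (centered_interval \<omega> c) \<and>
           cond_density (conf_set r a b) (centered_interval \<omega> c) \<le> 1 - \<delta>))"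

end

(* Put q = 2 \<delta>. To the right of 0 place a periodic comb of N blocks of length h, slightly less
   than q, separated by gaps of length 1, and after it one solid block of length L. Each end of
   a comb block is bad at radius 1, since the window meets only that block and h < q.
   The comb has average density q / (1 + q), although a fine homogeneous mixture that is bad
   merely by its average would have density below q / 2. Choose L just small enough that the
   ends of the solid block are bad (low density) at the radius reaching 0. Then 0 is bad
   (high density) at the radius reaching the end of the solid block iff, to leading order in N
   and with h = q, q^3 + q^2 + q > 1. *)

theory Submission
  imports Defs
begin

section \<open>Densities bounded through interval covers\<close>

lemma sets_conf_set: "conf_set r a b \<in> sets lebesgue"
  unfolding conf_set_def by (intro sets.Un sets.finite_UN) auto

lemma sets_centered_interval: "centered_interval \<omega> c \<in> sets lebesgue"
  unfolding centered_interval_def by auto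

lemma measure_centered_interval:
  "0 < \<omega> \<Longrightarrow> measure lebesgue (centered_interval \<omega> c) = 2 * \<omega>"
  unfolding centered_interval_def by simp

lemma measure_le_sum_lengths:
  fixes u v :: "nat \<Rightarrow> real"
  assumes "finite J" and "S \<in> sets lebesgue" and "S \<subseteq> (\<Union>i\<in>J. {u i..v i})"
    and "\<And>i. i \<in> J \<Longrightarrow> u i \<le> v i"
  shows "measure lebesgue S \<le> (\<Sum>i\<in>J. v i - u i)"
proof -
  have "measure lebesgue S \<le> measure lebesgue (\<Union>i\<in>J. {u i..v i})"
    using assms by (intro measure_mono_fmeasurable fmeasurable.finite_UN) auto
  also have "\<dots> \<le> (\<Sum>i\<in>J. measure lebesgue {u i..v i})"
    using assms(1) by (intro measure_UNION_le) auto
  also have "\<dots> = (\<Sum>i\<in>J. v i - u i)"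
    using assms(4) by (intro sum.cong) auto
  finally show ?thesis .
qed

text \<open>Subadditivity over a cover by closed intervals bounds the mass from above, and the
  window has length \<open>2 * \<omega>\<close>.\<close>

lemma low_density_at:
  fixes u v :: "nat \<Rightarrow> real"
  assumes "0 < \<omega>" and "finite J" and "H \<in> sets lebesgue"
    and "H \<inter> centered_interval \<omega> c \<subseteq> (\<Union>i\<in>J. {u i..v i})"
    and "\<And>i. i \<in> J \<Longrightarrow> u i \<le> v i"
    and "(\<Sum>i\<in>J. v i - u i) < 2 * \<delta> * \<omega>"
  shows "cond_density H (centered_interval \<omega> c) < \<delta>"
proof -
  have "measure lebesgue (H \<inter> centered_interval \<omega> c) \<le> (\<Sum>i\<in>J. v i - u i)"
    using assms by (intro measure_le_sum_lengths sets.Int sets_centered_interval) auto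
  with assms(6) have "measure lebesgue (H \<inter> centered_interval \<omega> c) < \<delta> * (2 * \<omega>)"
    by (simp add: mult.assoc mult.left_commute)
  with assms(1) show ?thesis
    by (simp add: cond_density_def measure_centered_interval pos_divide_less_eq)
qed

text \<open>The densities of \<open>H\<close> and of its complement add up to 1, so this is
  \<open>low_density_at\<close> applied to \<open>- H\<close>.\<close>

lemma high_density_at:
  fixes u v :: "nat \<Rightarrow> real"
  assumes "0 < \<omega>" and "finite J" and "H \<in> sets lebesgue"
    and "centered_interval \<omega> c - H \<subseteq> (\<Union>i\<in>J. {u i..v i})"
    and "\<And>i. i \<in> J \<Longrightarrow> u i \<le> v i"
    and "(\<Sum>i\<in>J. v i - u i) < 2 * \<delta> * \<omega>"
  shows "cond_density H (centered_interval \<omega> c) > 1 - \<delta>"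
proof -
  let ?I = "centered_interval \<omega> c"
  have "cond_density (- H) ?I < \<delta>"
    using assms by (intro low_density_at[of \<omega> J _ c u v]) (auto simp: Compl_in_sets_lebesgue)
  moreover have "cond_density H ?I + cond_density (- H) ?I = 1"
  proof -
    have "?I \<in> fmeasurable lebesgue"
      unfolding centered_interval_def by auto
    then have "measure lebesgue (?I - ?I \<inter> H) = measure lebesgue ?I - measure lebesgue (?I \<inter> H)"
      using assms(3) by (intro measurable_measure_Diff) (auto simp: fmeasurableD)
    then show ?thesis
      using assms(1)
      by (simp add: cond_density_def measure_centered_interval add_divide_distrib[symmetric]
          Int_commute Diff_eq Compl_Int inf_sup_distrib1 flip: Int_assoc)
  qed
  ultimately show ?thesis by linarith
qed

section \<open>The comb followed by a solid block\<close>

definition comb_left :: "real \<Rightarrow> nat \<Rightarrow> real" where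
  "comb_left h i = (real i - 1) * (1 + h) + 1"

text \<open>A period has length \<open>1 + h\<close>: first the gap, then the block. The solid block
  has index N + 1 and also follows a unit gap, so its left end fits the formula of
  \<open>comb_left\<close>.\<close>

definition comb_right :: "real \<Rightarrow> nat \<Rightarrow> real \<Rightarrow> nat \<Rightarrow> real" where
  "comb_right h N L i = (if i \<le> N then real i * (1 + h) else real N * (1 + h) + 1 + L)"

lemma comb_left_Suc: "comb_left h (Suc i) = real i * (1 + h) + 1"
  by (simp add: comb_left_def)

lemma comb_length: "i \<le> N \<Longrightarrow> comb_right h N L i - comb_left h i = h"
  by (simp add: comb_left_def comb_right_def algebra_simps)

lemma last_block_length: "comb_right h N L (Suc N) - comb_left h (Suc N) = L"
  by (simp add: comb_left_def comb_right_def)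

lemma comb_left_le_right:
  assumes "0 < h" "0 < L" "i \<le> Suc N"
  shows "comb_left h i < comb_right h N L i"
  using assms comb_length[of i N h L] last_block_length[of h N L] by (cases "i = Suc N") auto

lemma is_configuration_comb:
  assumes "0 < h" "0 < L"
  shows "is_configuration (Suc N) (comb_left h) (comb_right h N L)"
  unfolding is_configuration_def
proof (intro conjI ballI)
  show "comb_left h i < comb_right h N L i" if "i \<in> {1..Suc N}" for i
    using that assms comb_left_le_right by auto
  show "comb_right h N L i < comb_left h (i + 1)" if "i \<in> {1..<Suc N}" for i
    using that by (simp add: comb_left_def comb_right_def)
qed (auto simp: comb_left_def)

text \<open>Block i has a unit gap on each side, so extending it by 1 both ways reaches no other
  component.\<close>

lemma comb_window:
  assumes "0 < h" "1 \<le> i" "i \<le> N"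
  shows "conf_set (Suc N) (comb_left h) (comb_right h N L)
      \<inter> {comb_left h i - 1<..<comb_right h N L i + 1} \<subseteq> {comb_left h i..comb_right h N L i}"
proof
  fix x
  assume x: "x \<in> conf_set (Suc N) (comb_left h) (comb_right h N L)
      \<inter> {comb_left h i - 1<..<comb_right h N L i + 1}"
  \<comment> \<open>The gap before the first block begins at 0, so the window avoids the negative
    half-line and x lies in some block j.\<close>
  have "comb_left h i - 1 \<ge> 0"
    using assms by (simp add: comb_left_def)
  with x obtain j where j: "j \<in> {1..Suc N}" "comb_left h j < x" "x < comb_right h N L j"
    by (auto simp: conf_set_def)
  have "\<not> j < i"
  proof
    assume "j < i"
    then have "real j * (1 + h) \<le> (real i - 1) * (1 + h)"
      using assms(1) by (intro mult_right_mono) auto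
    with \<open>j < i\<close> j x assms show False
      by (auto simp: comb_left_def comb_right_def)
  qed
  moreover have "\<not> i < j"
  proof
    assume "i < j"
    then have "real i * (1 + h) \<le> (real j - 1) * (1 + h)"
      using assms(1) by (intro mult_right_mono) auto
    with j x assms show False
      by (auto simp: comb_left_def comb_right_def)
  qed
  ultimately show "x \<in> {comb_left h i..comb_right h N L i}"
    using j by auto
qed

text \<open>A missed point lies in the gap of its own period or in the gap before the solid block.
  The gaps are closed so as to take in the endpoints, which the open blocks omit.\<close>

lemma comb_gaps_cover:
  assumes "0 < h" and "0 \<le> x" and "x < comb_right h N L (Suc N)"
    and "x \<notin> conf_set (Suc N) (comb_left h) (comb_right h N L)"
  shows "\<exists>n\<le>N. x \<in> {real n * (1 + h)..real n * (1 + h) + 1}"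
proof -
  \<comment> \<open>The index of the period containing x.\<close>
  define m where "m = nat \<lfloor>x / (1 + h)\<rfloor>"
  have "real m \<le> x / (1 + h)" "x / (1 + h) < real m + 1"
    using assms unfolding m_def by (auto simp: le_floor_iff)
  then have m: "real m * (1 + h) \<le> x" "x < (real m + 1) * (1 + h)"
    using assms(1) by (auto simp: field_simps)
  have notin: "\<not> (comb_left h i < x \<and> x < comb_right h N L i)" if "i \<in> {1..Suc N}" for i
    using assms(4) that by (auto simp: conf_set_def)
  show ?thesis
  proof (cases "m < N")
    case True
    then have "x \<le> real m * (1 + h) + 1"
      using notin[of "Suc m"] m by (auto simp: comb_left_def comb_right_def add.commute)
    with m True show ?thesis by (intro exI[of _ m]) auto
  next
    \<comment> \<open>Past the N periods only gap N remains, since x lies before the right end of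
      the solid block.\<close>
    case False
    then have "real N * (1 + h) \<le> real m * (1 + h)"
      using assms(1) by (intro mult_right_mono) auto
    with m notin[of "Suc N"] assms(3) show ?thesis
      by (intro exI[of _ N]) (auto simp: comb_left_def)
  qed
qed

section \<open>Bad radii for the endpoints\<close>

lemma comb_endpoints_low:
  assumes "0 < h" "h < 2 * \<delta>" "2 * \<delta> \<le> 1" "1 \<le> i" "i \<le> N"
    and "c = comb_left h i \<or> c = comb_right h N L i"
  shows "cond_density (conf_set (Suc N) (comb_left h) (comb_right h N L))
      (centered_interval 1 c) < \<delta>"
proof (rule low_density_at[where J = "{i}" and u = "comb_left h" and v = "comb_right h N L"])
  have len: "comb_right h N L i - comb_left h i = h"
    using assms(5) by (rule comb_length)
  have "centered_interval 1 c \<subseteq> {comb_left h i - 1<..<comb_right h N L i + 1}"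
    using len assms(1,6) by (auto simp: centered_interval_def)
  then show "conf_set (Suc N) (comb_left h) (comb_right h N L) \<inter> centered_interval 1 c
      \<subseteq> (\<Union>j\<in>{i}. {comb_left h j..comb_right h N L j})"
    using comb_window[OF assms(1,4,5), of L] by blast
qed (use assms comb_length[of i N h L] sets_conf_set in auto)

text \<open>The window is (0, 2c): it misses the negative half-line, so it carries at most the total
  length of all the blocks.\<close>

lemma last_block_low:
  assumes "0 < h" "0 < L" "0 < c" "real N * h + L < 2 * \<delta> * c"
  shows "cond_density (conf_set (Suc N) (comb_left h) (comb_right h N L))
      (centered_interval c c) < \<delta>"
proof (rule low_density_at[where J = "{1..Suc N}" and u = "comb_left h" and v = "comb_right h N L"])
  have "(\<Sum>i\<in>{1..Suc N}. comb_right h N L i - comb_left h i) = real N * h + L"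
    by (simp add: comb_length last_block_length)
  with assms(4) show "(\<Sum>i\<in>{1..Suc N}. comb_right h N L i - comb_left h i) < 2 * \<delta> * c"
    by simp
  show "conf_set (Suc N) (comb_left h) (comb_right h N L) \<inter> centered_interval c c
      \<subseteq> (\<Union>i\<in>{1..Suc N}. {comb_left h i..comb_right h N L i})"
    by (force simp: conf_set_def centered_interval_def)
qed (use assms comb_left_le_right[of h L] sets_conf_set in \<open>auto intro: less_imp_le\<close>)

text \<open>The half-line fills the left half of the window, and the right half ends with the solid
  block, so only the N + 1 unit gaps are missing.\<close>

lemma zero_high:
  fixes h L :: real and N :: nat
  defines "\<omega> \<equiv> comb_right h N L (Suc N)"
  assumes "0 < h" "0 < L" "real N + 1 < 2 * \<delta> * \<omega>"
  shows "cond_density (conf_set (Suc N) (comb_left h) (comb_right h N L))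
      (centered_interval \<omega> 0) > 1 - \<delta>"
proof (rule high_density_at[where J = "{..N}" and u = "\<lambda>n. real n * (1 + h)"
      and v = "\<lambda>n. real n * (1 + h) + 1"])
  show "0 < \<omega>"
    using assms(2,3) by (simp add: \<omega>_def comb_right_def add_nonneg_pos)
  show "centered_interval \<omega> 0 - conf_set (Suc N) (comb_left h) (comb_right h N L)
      \<subseteq> (\<Union>n\<in>{..N}. {real n * (1 + h)..real n * (1 + h) + 1})"
  proof
    fix x
    assume x: "x \<in> centered_interval \<omega> 0 - conf_set (Suc N) (comb_left h) (comb_right h N L)"
    then have "0 \<le> x"
      by (auto simp: conf_set_def not_less)
    with x comb_gaps_cover[OF assms(2), of x N L]
    show "x \<in> (\<Union>n\<in>{..N}. {real n * (1 + h)..real n * (1 + h) + 1})"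
      by (auto simp: centered_interval_def \<omega>_def)
  qed
  show "(\<Sum>n\<in>{..N}. real n * (1 + h) + 1 - real n * (1 + h)) < 2 * \<delta> * \<omega>"
    using assms(4) by (simp add: add.commute)
qed (auto simp: sets_conf_set)

section \<open>Choice of block lengths and number of blocks\<close>

lemma comb_parameters:
  fixes q :: real
  assumes "0 < q" and "q ^ 3 + q ^ 2 + q > 1"
  obtains h L :: real and N :: nat
  where "0 < h" "h < q" "0 < L"
    "real N * h + L < q * (real N * (1 + h) + 1)"
    "real N + 1 < q * (real N * (1 + h) + 1 + L)"
proof -
  \<comment> \<open>The cubic hypothesis leaves room for an h below q with
    \<open>q ^ 2 * h > 1 - q - q ^ 2\<close>; the maximum with 0 below keeps h positive.\<close>
  have "(1 - q - q ^ 2) / q ^ 2 < q"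
    using assms by (simp add: pos_divide_less_eq power3_eq_cube power2_eq_square algebra_simps)
  with assms(1) obtain h where h: "max 0 ((1 - q - q ^ 2) / q ^ 2) < h" "h < q"
    using dense[of "max 0 ((1 - q - q ^ 2) / q ^ 2)" q] by auto
  \<comment> \<open>The gain per block in the inequality at 0: the coefficient of N in its right
    side minus its left side. A large N outweighs the constant term \<open>q - 1\<close>.\<close>
  define \<kappa> where "\<kappa> = q ^ 2 * h - (1 - q - q ^ 2)"
  have "0 < \<kappa>"
    using h(1) assms(1) by (simp add: \<kappa>_def pos_divide_less_eq mult.commute)
  then obtain N :: nat where N: "1 < real N * \<kappa>"
    using reals_Archimedean3 by blast
  then have "0 < N"
    by (cases N) auto
  \<comment> \<open>Solves \<open>N * h + L = q * N * (1 + h)\<close>, which leaves slack exactly q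
    in the inequality for the left end of the solid block.\<close>
  define L where "L = real N * (q + q * h - h)"
  show thesis
  proof
    show "0 < h" "h < q" using h by auto
    have "0 < q + q * h - h"
      using h assms(1) mult_pos_pos[of q h] by linarith
    with \<open>0 < N\<close> show "0 < L" by (simp add: L_def)
    show "real N * h + L < q * (real N * (1 + h) + 1)"
      using assms(1) by (simp add: L_def algebra_simps)
    have "q * (real N * (1 + h) + 1 + L) - (real N + 1) = real N * \<kappa> + q - 1"
      by (simp add: L_def \<kappa>_def power2_eq_square algebra_simps)
    with N assms(1) show "real N + 1 < q * (real N * (1 + h) + 1 + L)"
      by linarith
  qed
qed

theorem proposition3:
  fixes \<delta> :: real
  assumes "0 \<le> \<delta>" and "\<delta> \<le> 1 / 2"
    and "(2 * \<delta>) ^ 3 + (2 * \<delta>) ^ 2 + 2 * \<delta> > 1"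
  shows "\<not> K_property \<delta> \<and>
    (\<exists>r a b. is_configuration r a b \<and>
       (\<forall>c\<in>conf_endpoints r a b. \<exists>\<omega>>0.
          cond_density (conf_set r a b) (centered_interval \<omega> c) \<notin> {\<delta>..1 - \<delta>}))"
proof -
  \<comment> \<open>At \<delta> = 0 the cubic hypothesis would read 0 > 1.\<close>
  have "0 < 2 * \<delta>"
    using assms(1,3) by (cases "\<delta> = 0") auto
  then obtain h L :: real and N :: nat
    where h: "0 < h" "h < 2 * \<delta>" and L: "0 < L"
      and low: "real N * h + L < 2 * \<delta> * (real N * (1 + h) + 1)"
      and high: "real N + 1 < 2 * \<delta> * (real N * (1 + h) + 1 + L)"
    using comb_parameters[OF _ assms(3)] by blast
  define a where "a = comb_left h"
  define b where "b = comb_right h N L"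
  let ?bad = "\<lambda>c. \<exists>\<omega>>0. cond_density (conf_set (Suc N) a b) (centered_interval \<omega> c) \<notin> {\<delta>..1 - \<delta>}"
  have last: "a (Suc N) = real N * (1 + h) + 1" "b (Suc N) = real N * (1 + h) + 1 + L"
    by (simp_all add: a_def b_def comb_left_Suc comb_right_def)
  have pos: "0 < real N * (1 + h) + 1"
    using h(1) by (simp add: add_nonneg_pos)
  have comb: "?bad c" if "i \<in> {1..N}" "c = a i \<or> c = b i" for i c
    using comb_endpoints_low[of h \<delta> i N c L] that h assms(2)
    by (intro exI[of _ 1]) (auto simp: a_def b_def)
  \<comment> \<open>Moving from the left to the right end of the solid block raises
    \<open>2 * \<delta> * c\<close> by this amount, so \<open>low\<close> yields the bound at both
    ends.\<close>
  have "0 < 2 * \<delta> * L"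
    using L \<open>0 < 2 * \<delta>\<close> by (rule mult_pos_pos[rotated])
  then have "real N * h + L < 2 * \<delta> * (real N * (1 + h) + 1 + L)"
    using low unfolding distrib_left[of _ _ L] by linarith
  moreover have "?bad c" if "0 < c" "real N * h + L < 2 * \<delta> * c" for c
    using last_block_low[OF h(1) L that] that(1) by (intro exI[of _ c]) (simp add: a_def b_def)
  ultimately have solid: "?bad (a (Suc N))" "?bad (b (Suc N))"
    unfolding last using low L pos by simp_all
  have zero: "?bad 0"
    using zero_high[OF h(1) L, of N \<delta>] high L pos last(2)
    by (intro exI[of _ "b (Suc N)"]) (auto simp: a_def b_def)
  have conf: "is_configuration (Suc N) a b"
    unfolding a_def b_def using h(1) L by (rule is_configuration_comb)
  have bad: "\<forall>c\<in>conf_endpoints (Suc N) a b. ?bad c"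
  proof
    fix c
    assume "c \<in> conf_endpoints (Suc N) a b"
    then consider "c = 0" | i where "i \<in> {1..Suc N}" "c = a i \<or> c = b i"
      by (auto simp: conf_endpoints_def)
    then show "?bad c"
    proof cases
      case (2 i)
      then show ?thesis
        using comb[of i c] solid by (cases "i = Suc N") auto
    qed (use zero in simp)
  qed
  have "\<not> K_property \<delta>"
    unfolding K_property_def using conf bad by fastforce
  with conf bad show ?thesis by blast
qed

end
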